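(* Any binary mergesort has (worst-case) fragile complexity $\Omega(\log^2 n)$: there is an absolute constant $c>0$ such that for every $n$ and every binary mergesort algorithm, there is an input of $n$ elements on which some element participates in at least $c\log^2 n$ comparisons.
   Context: A binary mergesort is a deterministic comparison-based sorting algorithm that, on an input set of more than one element, splits it into two nonempty parts (of arbitrary sizes), sorts each part recursively (with no comparisons between elements of different parts), and then merges the two resulting sorted sequences using an arbitrary comparison-based merging procedure. Fragile complexity is the maximum number of comparisons any single element participates in. *)

theory Defs
  imports Complex_Main
begin

text \<open>
  A deterministic comparison-based procedure on elements of type 'a, with result of type 'r, is a
  finite comparison tree: elements are names (input positions), and the next step depends only on
  the outcomes of the earlier comparisons. The set function \<open>compared\<close> collects all
  elements occurring in some comparison of the tree.
\<close>

datatype (compared: 'a, results: 'r) ctree =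
  Return 'r
| Compare 'a 'a "('a, 'r) ctree" "('a, 'r) ctree"

text \<open>
  An input is given by an assignment of pairwise distinct keys to the elements. In
  \<open>Compare u v l r\<close> execution proceeds with \<open>l\<close> if u is smaller than v, and with
  \<open>r\<close> otherwise.
\<close>

primrec run :: "('a \<Rightarrow> nat) \<Rightarrow> ('a, 'r) ctree \<Rightarrow> 'r" where
  "run key (Return res) = res"
| "run key (Compare u v l r) = (if key u < key v then run key l else run key r)"

primrec comparisons :: "('a \<Rightarrow> nat) \<Rightarrow> ('a, 'r) ctree \<Rightarrow> 'a \<Rightarrow> nat" where
  "comparisons key (Return res) x = 0"
| "comparisons key (Compare u v l r) x =
     (if x = u \<or> x = v then 1 else 0) +
     (if key u < key v then comparisons key l x else comparisons key r x)"

definition fragile_complexity :: "('a \<Rightarrow> nat) \<Rightarrow> 'a set \<Rightarrow> ('a, 'r) ctree \<Rightarrow> nat" where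
  "fragile_complexity key S P = Max (comparisons key P ` S)"

text \<open>Sequential composition: the second procedure may use the result of the first.\<close>

primrec bind :: "('a, 'r) ctree \<Rightarrow> ('r \<Rightarrow> ('a, 's) ctree) \<Rightarrow> ('a, 's) ctree" where
  "bind (Return res) f = f res"
| "bind (Compare u v l r) f = Compare u v (bind l f) (bind r f)"

definition sorted_seq :: "('a \<Rightarrow> nat) \<Rightarrow> 'a set \<Rightarrow> 'a list \<Rightarrow> bool" where
  "sorted_seq key S zs \<longleftrightarrow> set zs = S \<and> sorted_wrt (\<lambda>x y. key x < key y) zs"

text \<open>
  A merging procedure may depend arbitrarily on the two given sequences of elements (hence on all
  order information obtained within the two parts), and compares only elements of the two parts.
\<close>

definition merging_procedure ::
    "'a set \<Rightarrow> 'a set \<Rightarrow> ('a list \<Rightarrow> 'a list \<Rightarrow> ('a, 'a list) ctree) \<Rightarrow> bool" where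
  "merging_procedure A B m \<longleftrightarrow>
     (\<forall>key xs ys. inj_on key (A \<union> B) \<longrightarrow> sorted_seq key A xs \<longrightarrow> sorted_seq key B ys \<longrightarrow>
        compared (m xs ys) \<subseteq> A \<union> B \<and>
        sorted_seq key (A \<union> B) (run key (m xs ys)))"

text \<open>
  \<open>binary_mergesort S P\<close>: P is the execution, on the element set S, of a binary mergesort.
  The split depends only on the set of elements and uses no comparisons (otherwise the split could
  already sort); its sizes, the recursive sorters and the merging procedure are arbitrary and may
  differ from call to call.
\<close>

inductive binary_mergesort :: "'a set \<Rightarrow> ('a, 'a list) ctree \<Rightarrow> bool" where
  single: "binary_mergesort {x} (Return [x])"
| split: "binary_mergesort (A \<union> B) (bind P (\<lambda>xs. bind Q (\<lambda>ys. m xs ys)))"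
    if "A \<noteq> {}" "B \<noteq> {}" "A \<inter> B = {}"
       "binary_mergesort A P" "binary_mergesort B Q" "merging_procedure A B m"

text \<open>Sanity checks: binary mergesorts sort correctly, and they exist for all sizes.\<close>

lemma run_bind: "run key (bind P f) = run key (f (run key P))"
  by (induction P) auto

lemma comparisons_bind:
  "comparisons key (bind P f) x = comparisons key P x + comparisons key (f (run key P)) x"
  by (induction P) auto

lemma binary_mergesort_sorts:
  assumes "binary_mergesort S P" "inj_on key S"
  shows "sorted_seq key S (run key P)"
  using assms
proof (induction rule: binary_mergesort.induct)
  case (single x)
  then show ?case by (simp add: sorted_seq_def)
next
  case (split A B P Q m)
  then have "sorted_seq key A (run key P)" "sorted_seq key B (run key Q)"
    by (auto simp: inj_on_Un)
  with split show ?case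
    by (auto simp: run_bind merging_procedure_def)
qed

fun std_merge :: "'a list \<Rightarrow> 'a list \<Rightarrow> 'a list \<Rightarrow> ('a, 'a list) ctree" where
  "std_merge acc [] ys = Return (acc @ ys)"
| "std_merge acc xs [] = Return (acc @ xs)"
| "std_merge acc (x # xs) (y # ys) =
     Compare x y (std_merge (acc @ [x]) xs (y # ys)) (std_merge (acc @ [y]) (x # xs) ys)"

lemma compared_std_merge: "compared (std_merge acc xs ys) \<subseteq> set xs \<union> set ys"
  by (induction acc xs ys rule: std_merge.induct) auto

lemma sorted_std_merge:
  assumes "inj_on key (set xs \<union> set ys)" "set xs \<inter> set ys = {}"
    and "sorted_wrt (\<lambda>x y. key x < key y) (acc @ xs)" "sorted_wrt (\<lambda>x y. key x < key y) (acc @ ys)"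
  shows "sorted_seq key (set acc \<union> set xs \<union> set ys) (run key (std_merge acc xs ys))"
  using assms
proof (induction acc xs ys rule: std_merge.induct)
  case (3 acc x xs y ys)
  have "key x \<noteq> key y"
    using 3(3,4) by (auto simp: inj_on_def)
  then consider "key x < key y" | "key y < key x" by linarith
  then show ?case
  proof cases
    case 1
    have "sorted_seq key (set (acc @ [x]) \<union> set xs \<union> set (y # ys))
            (run key (std_merge (acc @ [x]) xs (y # ys)))"
      using 3(3-6) 1 by (intro 3(1)) (fastforce simp: sorted_wrt_append inj_on_def)+
    with 1 show ?thesis by (simp add: insert_commute Un_assoc)
  next
    case 2
    have "sorted_seq key (set (acc @ [y]) \<union> set (x # xs) \<union> set ys)
            (run key (std_merge (acc @ [y]) (x # xs) ys))"
      using 3(3-6) 2 by (intro 3(2)) (fastforce simp: sorted_wrt_append inj_on_def)+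
    with 2 show ?thesis by (simp add: insert_commute Un_assoc)
  qed
qed (auto simp: sorted_seq_def)

lemma merging_procedure_std:
  assumes "A \<inter> B = {}"
  shows "merging_procedure A B (std_merge [])"
  unfolding merging_procedure_def
proof (intro allI impI conjI)
  fix key :: "'a \<Rightarrow> nat" and xs ys
  assume "inj_on key (A \<union> B)" "sorted_seq key A xs" "sorted_seq key B ys"
  with assms show "compared (std_merge [] xs ys) \<subseteq> A \<union> B"
      "sorted_seq key (A \<union> B) (run key (std_merge [] xs ys))"
    using compared_std_merge[of "[]" xs ys] sorted_std_merge[of key xs ys "[]"]
    by (auto simp: sorted_seq_def)
qed

lemma binary_mergesort_exists:
  assumes "finite S" "S \<noteq> {}"
  shows "\<exists>P. binary_mergesort S P"
  using assms
proof (induction rule: finite_ne_induct)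
  case (singleton x)
  show ?case by (rule exI, rule binary_mergesort.single)
next
  case (insert x F)
  then obtain Q where "binary_mergesort F Q" by blast
  with insert have "binary_mergesort ({x} \<union> F)
      (bind (Return [x]) (\<lambda>xs. bind Q (\<lambda>ys. std_merge [] xs ys)))"
    by (intro binary_mergesort.intros merging_procedure_std) auto
  then show ?case by auto
qed

end

theory Submission
  imports Defs
begin

text \<open>
  Descend from the root of the recursion tree into the larger part until a single element x is
  reached, and let B range over the other parts of the merges met on this path. An adversary nests
  the keys: all of B lies in the gap around x of the sequence that contains x so far, so every
  merge has to locate x among the elements of B. Comparisons not involving x do not help with this,
  hence x takes part in at least log (|B| + 1) comparisons of the merge. As
  \<open>log\<^sup>2 (a + b) - log\<^sup>2 a\<close> is at most a constant times \<open>log (b + 1)\<close> for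
  \<open>b \<le> a\<close>, these bounds sum up to a constant fraction of \<open>log\<^sup>2 n\<close>.
\<close>

section \<open>Executions depend only on the order of the keys\<close>

definition same_order :: "'a set \<Rightarrow> ('a \<Rightarrow> nat) \<Rightarrow> ('a \<Rightarrow> nat) \<Rightarrow> bool" where
  "same_order S f g \<longleftrightarrow> (\<forall>u\<in>S. \<forall>v\<in>S. f u < f v \<longleftrightarrow> g u < g v)"

lemma same_order_subset: "same_order S f g \<Longrightarrow> T \<subseteq> S \<Longrightarrow> same_order T f g"
  by (auto simp: same_order_def)

lemma same_order_compared:
  assumes "same_order S f g" "compared T \<subseteq> S"
  shows "run f T = run g T \<and> comparisons f T = comparisons g T"
  using assms(2)
proof (induction T)
  case (Compare u v l r)
  then have "f u < f v \<longleftrightarrow> g u < g v"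
    using assms(1) by (auto simp: same_order_def)
  with Compare show ?case by (auto simp: fun_eq_iff)
qed (simp add: fun_eq_iff)

text \<open>Either key puts \<open>zs ! i\<close> below \<open>zs ! j\<close> exactly when
  \<open>i < j\<close>. Read contrapositively, inputs that are ordered differently need different
  outputs; \<open>merge_adversary\<close> rests on this.\<close>

lemma same_order_if_sorted_seq:
  assumes "sorted_seq f S zs" "sorted_seq g S zs"
  shows "same_order S f g"
proof -
  have less: "k (zs ! i) < k (zs ! j) \<longleftrightarrow> i < j"
    if "sorted_seq k S zs" "i < length zs" "j < length zs" for k :: "'a \<Rightarrow> nat" and i j
  proof -
    have "k (zs ! p) < k (zs ! q)" if "p < q" "q < length zs" for p q
      using \<open>sorted_seq k S zs\<close> that by (auto simp: sorted_seq_def sorted_wrt_iff_nth_less)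
    then show ?thesis
      using that(2,3) by (metis less_asym less_irrefl linorder_neqE_nat)
  qed
  have "S = set zs"
    using assms(1) by (simp add: sorted_seq_def)
  then show ?thesis
    using less[OF assms(1)] less[OF assms(2)] by (auto simp: same_order_def in_set_conv_nth)
qed

lemma finite_binary_mergesort:
  assumes "binary_mergesort S P"
  shows "finite S"
  using assms by induction auto

text \<open>
  A bound on \<open>compared P\<close> would not do here: P may have unreachable branches whose
  results are not sorted sequences, and on these the merging procedure is unconstrained.
\<close>

lemma binary_mergesort_same_order:
  assumes "binary_mergesort S P" "inj_on f S" "inj_on g S" "same_order S f g"
  shows "run f P = run g P \<and> comparisons f P = comparisons g P"
  using assms
proof induction
  case (split A B P Q m)
  let ?T = "m (run f P) (run f Q)"
  have inj: "inj_on f A" "inj_on f B" "inj_on g A" "inj_on g B"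
    using split.prems by (auto simp: inj_on_Un)
  have PQ: "run f P = run g P \<and> comparisons f P = comparisons g P"
    "run f Q = run g Q \<and> comparisons f Q = comparisons g Q"
    using split.IH inj split.prems(3) by (auto intro: same_order_subset)
  have "sorted_seq f A (run f P)" "sorted_seq f B (run f Q)"
    using split.hyps(4,5) inj binary_mergesort_sorts by auto
  then have "compared ?T \<subseteq> A \<union> B"
    using split.hyps(6) split.prems(1) unfolding merging_procedure_def by blast
  then have "run f ?T = run g ?T \<and> comparisons f ?T = comparisons g ?T"
    using split.prems(3) same_order_compared by blast
  with PQ show ?case by (auto simp: run_bind comparisons_bind fun_eq_iff)
qed (simp add: fun_eq_iff)

section \<open>The cost of one merge for a chosen element\<close>

text \<open>
  The inputs differ only in the key of x, so only comparisons that involve x distinguish them.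
\<close>

lemma card_le_power_comparisons:
  assumes "finite I" "I \<noteq> {}" "inj_on (\<lambda>c. run (h(x := c)) T) I"
  shows "\<exists>c\<in>I. card I \<le> 2 ^ comparisons (h(x := c)) T x"
  using assms
proof (induction T arbitrary: I)
  case (Return r)
  then obtain c where "c \<in> I" by blast
  moreover from this Return.prems(3) have "I = {c}"
    by (auto simp: inj_on_def)
  ultimately show ?case by simp
next
  case (Compare u v l r)
  define less where "less c \<longleftrightarrow> (h(x := c)) u < (h(x := c)) v" for c
  define L where "L = {c \<in> I. less c}"
  define R where "R = {c \<in> I. \<not> less c}"
  have fin: "finite L" "finite R"
    using Compare.prems(1) by (auto simp: L_def R_def)
  have injL: "inj_on (\<lambda>c. run (h(x := c)) l) L" and injR: "inj_on (\<lambda>c. run (h(x := c)) r) R"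
    using Compare.prems(3) unfolding inj_on_def L_def R_def less_def by auto
  have compL: "comparisons (h(x := c)) (Compare u v l r) x
      = (if x = u \<or> x = v then 1 else 0) + comparisons (h(x := c)) l x" if "c \<in> L" for c
    using that by (simp add: L_def less_def)
  have compR: "comparisons (h(x := c)) (Compare u v l r) x
      = (if x = u \<or> x = v then 1 else 0) + comparisons (h(x := c)) r x" if "c \<in> R" for c
    using that by (simp add: R_def less_def)
  have subset: "L \<subseteq> I" "R \<subseteq> I"
    by (auto simp: L_def R_def)
  have card: "card I = card L + card R"
  proof -
    have "I = L \<union> R" "L \<inter> R = {}"
      by (auto simp: L_def R_def)
    then show ?thesis using fin by (simp add: card_Un_disjoint)
  qed
  have pos: "card I > 0"
    using Compare.prems(1,2) by (simp add: card_gt_0_iff)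
  have branch: "card L = 0 \<or> card R = 0" if "\<not> (x = u \<or> x = v)"
  proof -
    have "L = {} \<or> R = {}"
      using that by (auto simp: L_def R_def less_def)
    then show ?thesis by auto
  qed
  \<comment> \<open>The larger of \<open>L\<close> and \<open>R\<close> is followed. It holds at
    least half of \<open>I\<close>, which a comparison of \<open>x\<close> pays for; if
    \<open>x\<close> is not compared, the other side is empty and nothing is lost.\<close>
  show ?case
  proof (cases "card R \<le> card L")
    case True
    then have "L \<noteq> {}" using card pos by auto
    then obtain c where c: "c \<in> L" "card L \<le> 2 ^ comparisons (h(x := c)) l x"
      using Compare.IH(1)[OF fin(1) _ injL] by blast
    then have "card I \<le> 2 ^ comparisons (h(x := c)) (Compare u v l r) x"
      using compL[OF c(1)] card True branch by auto
    then show ?thesis using c(1) subset by blast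
  next
    case False
    then have "R \<noteq> {}" by auto
    then obtain c where c: "c \<in> R" "card R \<le> 2 ^ comparisons (h(x := c)) r x"
      using Compare.IH(2)[OF fin(2) _ injR] by blast
    then have "card I \<le> 2 ^ comparisons (h(x := c)) (Compare u v l r) x"
      using compR[OF c(1)] card False branch by auto
    then show ?thesis using c(1) subset by blast
  qed
qed

text \<open>\<open>T\<close> has to sort only keys extending the fixed orders of \<open>A\<close>
  and \<open>B\<close>, since a merge receives both sequences already sorted. Among such keys
  \<open>x\<close> can take \<open>card B + 1\<close> places relative to \<open>B\<close>. Each
  place requires its own output, so \<open>card_le_power_comparisons\<close> applies.\<close>

lemma merge_adversary:
  fixes f g :: "'a \<Rightarrow> nat"
  assumes "finite B" "A \<inter> B = {}" "x \<in> A" "inj_on f A" "inj_on g B"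
    and sorts: "\<And>key. inj_on key (A \<union> B) \<Longrightarrow> same_order A f key \<Longrightarrow> same_order B g key \<Longrightarrow>
      sorted_seq key (A \<union> B) (run key T)"
  obtains key where "inj_on key (A \<union> B)" "same_order A f key" "same_order B g key"
    "card B + 1 \<le> 2 ^ comparisons key T x"
proof -
  obtain N where N: "g z < N" if "z \<in> B" for z
    using \<open>finite B\<close> by (metis finite_imageI finite_nat_set_iff_bounded imageI)
  \<comment> \<open>\<open>B\<close> sits at odd distances above \<open>f x\<close>, leaving the
    even ones free for \<open>x\<close>. The shift by \<open>2 * N + 1\<close> lifts the elements of
    \<open>A\<close> above \<open>x\<close> beyond all of these, as \<open>g < N\<close> on
    \<open>B\<close>.\<close>
  define h where
    "h z = (if z \<in> B then f x + 2 * g z + 1 else if f z < f x then f z else f z + 2 * N + 1)" for z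
  define position where "position t = f x + 2 * t" for t
  \<comment> \<open>\<open>position 0\<close> lies below all of \<open>B\<close>, and
    \<open>position (g z + 1)\<close> directly above \<open>z\<close>.\<close>
  define I where "I = position ` insert 0 ((\<lambda>z. g z + 1) ` B)"
  have key: "inj_on (h(x := c)) (A \<union> B) \<and> same_order A f (h(x := c)) \<and> same_order B g (h(x := c))"
    if "c \<in> I" for c
  proof -
    have "t \<le> N" if "t \<in> insert 0 ((\<lambda>z. g z + 1) ` B)" for t
      using that N by (auto simp: Suc_le_eq)
    with \<open>c \<in> I\<close> obtain t where c: "c = f x + 2 * t" and t: "t \<le> N"
      unfolding I_def position_def by blast
    let ?k = "h(x := c)"
    have xB: "x \<notin> B" using assms by auto
    have kB: "?k z = f x + 2 * g z + 1" if "z \<in> B" for z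
      using that xB by (auto simp: h_def)
    have kA: "?k z = (if f z < f x then f z else f z + 2 * N + 1) \<and> f z \<noteq> f x"
      if "z \<in> A" "z \<noteq> x" for z
      using that assms by (auto simp: h_def inj_on_def)
    have kx: "?k x = f x + 2 * t"
      by (simp add: c)
    have A: "same_order A f ?k"
      unfolding same_order_def
    proof (intro ballI)
      fix u v assume "u \<in> A" "v \<in> A"
      then show "f u < f v \<longleftrightarrow> ?k u < ?k v"
        using kA[of u] kA[of v] kx t
        by (cases "u = x"; cases "v = x") (simp_all split: if_splits)
    qed
    have B: "same_order B g ?k"
      unfolding same_order_def using kB by simp
    have injA: "inj_on ?k A"
      using A \<open>inj_on f A\<close> unfolding same_order_def inj_on_def by (metis less_irrefl linorder_neqE_nat)
    have injB: "inj_on ?k B"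
      using B \<open>inj_on g B\<close> unfolding same_order_def inj_on_def by (metis less_irrefl linorder_neqE_nat)
    have "?k u \<noteq> ?k v" if "u \<in> A" "v \<in> B" for u v
    proof (cases "u = x")
      case True
      have "f x + 2 * t \<noteq> f x + 2 * g v + 1" by presburger
      then show ?thesis using kx kB[OF that(2)] True by simp
    next
      case False
      then show ?thesis
        using kA[OF that(1)] kB[OF that(2)] N[OF that(2)] by auto
    qed
    then have "inj_on ?k (A \<union> B)"
      using injA injB by (fastforce simp: inj_on_Un)
    with A B show ?thesis by blast
  qed
  have sorted: "sorted_seq (h(x := c)) (A \<union> B) (run (h(x := c)) T)" if "c \<in> I" for c
    using key[OF that] sorts by blast
  have separated: "run (h(x := position s)) T \<noteq> run (h(x := position t)) T"
    if st: "position s \<in> I" "position t \<in> I" "s < t" for s t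
  proof
    assume "run (h(x := position s)) T = run (h(x := position t)) T"
    then have same: "same_order (A \<union> B) (h(x := position s)) (h(x := position t))"
      using sorted[OF st(1)] sorted[OF st(2)] same_order_if_sorted_seq by metis
    \<comment> \<open>As \<open>s < t\<close>, the index \<open>t\<close> is not 0 and comes from
      some \<open>w\<close>. Then \<open>s\<close> is at most \<open>g w\<close>, so
      \<open>w\<close> lies strictly between the two positions of \<open>x\<close>.\<close>
    obtain w where "w \<in> B" "t = g w + 1"
      using st(2,3) by (auto simp: I_def position_def)
    moreover from this have "w \<noteq> x"
      using assms(2,3) by auto
    ultimately have "(h(x := position s)) x < (h(x := position s)) w"
      "\<not> (h(x := position t)) x < (h(x := position t)) w"
      using st(3) by (auto simp: h_def position_def)
    moreover have "w \<in> A \<union> B" "x \<in> A \<union> B"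
      using \<open>w \<in> B\<close> \<open>x \<in> A\<close> by auto
    ultimately show False
      using same unfolding same_order_def by meson
  qed
  have "inj_on (\<lambda>c. run (h(x := c)) T) I"
  proof (rule inj_onI, rule ccontr)
    fix c d
    assume cd: "c \<in> I" "d \<in> I" "run (h(x := c)) T = run (h(x := d)) T" "c \<noteq> d"
    then obtain s t where "c = position s" "d = position t"
      by (auto simp: I_def)
    with cd show False
      using separated[of s t] separated[of t s] by (metis linorder_neqE_nat)
  qed
  moreover have "finite I" "I \<noteq> {}"
    using \<open>finite B\<close> by (auto simp: I_def)
  ultimately obtain c where c: "c \<in> I" "card I \<le> 2 ^ comparisons (h(x := c)) T x"
    by (metis card_le_power_comparisons)
  have "card I = card (insert 0 ((\<lambda>z. g z + 1) ` B))"
    unfolding I_def by (rule card_image) (auto simp: inj_on_def position_def)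
  also have "\<dots> = card ((\<lambda>z. g z + 1) ` B) + 1"
    using \<open>finite B\<close> by (subst card_insert_disjoint) auto
  also have "card ((\<lambda>z. g z + 1) ` B) = card B"
    using \<open>inj_on g B\<close> by (intro card_image) (simp add: inj_on_def)
  finally show thesis
    using that[of "h(x := c)"] key[OF c(1)] c(2) by simp
qed

section \<open>Growth of the squared logarithm\<close>

lemma log_square_add_le:
  fixes a b :: nat
  assumes "1 \<le> b" "b \<le> a"
  shows "(log 2 (real (a + b)))\<^sup>2 / 8 \<le> (log 2 (real a))\<^sup>2 / 8 + log 2 (real (b + 1))"
proof -
  define x y where "x = real a" and "y = real b"
  define n where "n = x + y"
  have xy: "1 \<le> y" "y \<le> x"
    using assms by (auto simp: x_def y_def)
  then have n: "1 \<le> n" "x \<le> n" "n \<le> 2 * x"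
    by (auto simp: n_def)
  \<comment> \<open>Concavity: the chord of \<open>ln (1 + t)\<close> from 0 to \<open>n - 1\<close>
    lies below the graph at \<open>t = y\<close>, and dividing by \<open>n\<close> instead of
    \<open>n - 1\<close> only weakens this. The computation uses \<open>ln v \<le> v - 1\<close> at
    \<open>n / (1 + y)\<close> and at \<open>1 / (1 + y)\<close>.\<close>
  have chord: "y * ln n \<le> n * ln (1 + y)"
  proof -
    have "ln n - ln (1 + y) \<le> n / (1 + y) - 1"
      using ln_le_minus_one[of "n / (1 + y)"] xy n by (simp add: ln_div)
    also have "\<dots> \<le> x / (1 + y)"
      using xy by (simp add: n_def field_simps)
    finally have "y * (ln n - ln (1 + y)) \<le> y * (x / (1 + y))"
      using xy by (intro mult_left_mono) auto
    also have "\<dots> = x * (1 - 1 / (1 + y))"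
      using xy by (simp add: field_simps)
    also have "\<dots> \<le> x * ln (1 + y)"
    proof -
      have "- ln (1 + y) \<le> 1 / (1 + y) - 1"
        using ln_le_minus_one[of "1 / (1 + y)"] xy by (simp add: ln_div)
      then show ?thesis using xy by (intro mult_left_mono) auto
    qed
    finally show ?thesis by (simp add: n_def algebra_simps)
  qed
  have "ln n - ln x \<le> n / x - 1"
    using ln_le_minus_one[of "n / x"] xy n by (simp add: ln_div)
  also have "\<dots> = y / x"
    using xy by (simp add: n_def field_simps)
  \<comment> \<open>This is where the other part being the smaller one matters: it gives
    \<open>n \<le> 2 * x\<close>.\<close>
  also have "\<dots> \<le> 2 * y / n"
    using xy n by (simp add: field_simps)
  finally have diff: "ln n - ln x \<le> 2 * y / n" .
  have "(ln n)\<^sup>2 - (ln x)\<^sup>2 = (ln n - ln x) * (ln n + ln x)"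
    by (simp add: power2_eq_square algebra_simps)
  also have "\<dots> \<le> (2 * y / n) * (2 * ln n)"
    using diff xy n by (intro mult_mono) auto
  also have "\<dots> = 4 * (y * ln n) / n"
    by simp
  also have "\<dots> \<le> 4 * ln (1 + y)"
    using chord n by (simp add: field_simps)
  finally have main: "(ln n)\<^sup>2 - (ln x)\<^sup>2 \<le> 4 * ln (1 + y)" .
  \<comment> \<open>Origin of the constant 8: passing to base 2 divides by the square of
    \<open>ln 2\<close>, and one factor \<open>ln 2\<close> is gained by doubling the 4.\<close>
  have half: "1 / 2 \<le> ln (2 :: real)"
    using ln_le_minus_one[of "1 / 2 :: real"] by (simp add: ln_div)
  have "4 * ln (1 + y) \<le> 8 * ln (1 + y) * ln 2"
    using half xy by (simp add: field_simps)
  with main have "(ln n)\<^sup>2 \<le> (ln x)\<^sup>2 + 8 * ln (1 + y) * ln 2"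
    by simp
  then have "(ln n)\<^sup>2 / (ln 2)\<^sup>2 \<le> ((ln x)\<^sup>2 + 8 * ln (1 + y) * ln 2) / (ln 2)\<^sup>2"
    by (intro divide_right_mono) auto
  then have "(log 2 n)\<^sup>2 \<le> (log 2 x)\<^sup>2 + 8 * log 2 (1 + y)"
    by (simp add: log_def power_divide add_divide_distrib power2_eq_square)
  then show ?thesis
    by (simp add: n_def x_def y_def add.commute)
qed

lemma log_square_card_step:
  assumes "finite A" "finite B" "B \<noteq> {}" "A \<inter> B = {}" "card B \<le> card A"
    and "(log 2 (card A))\<^sup>2 / 8 \<le> real p" "card B + 1 \<le> 2 ^ q" "p + q \<le> k"
  shows "(log 2 (card (A \<union> B)))\<^sup>2 / 8 \<le> real k"
proof -
  have "1 \<le> card B"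
    using assms(2,3) by (simp add: Suc_le_eq card_gt_0_iff)
  moreover have "log 2 (card B + 1) \<le> real q"
    using assms(7) by (simp only: log2_of_power_le)
  ultimately show ?thesis
    using log_square_add_le[of "card B" "card A"] assms by (simp add: card_Un_disjoint)
qed

section \<open>Induction over the recursion tree\<close>

text \<open>The induction names the element \<open>x\<close>, because the cost of the merge must
  fall on the very element that was already expensive in its part. The combined key keeps the orders
  chosen for both parts, so the counts obtained there persist.\<close>

lemma binary_mergesort_lower_bound:
  assumes "binary_mergesort S P"
  shows "\<exists>key x. inj_on key S \<and> x \<in> S \<and> (log 2 (card S))\<^sup>2 / 8 \<le> comparisons key P x"
  using assms
proof induction
  case (single x)
  then show ?case by auto
next
  case (split A B P Q m)
  obtain f x where f: "inj_on f A" "x \<in> A" "(log 2 (card A))\<^sup>2 / 8 \<le> comparisons f P x"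
    using split.IH(1) by blast
  obtain g y where g: "inj_on g B" "y \<in> B" "(log 2 (card B))\<^sup>2 / 8 \<le> comparisons g Q y"
    using split.IH(2) by blast
  have fin: "finite A" "finite B"
    using split.hyps finite_binary_mergesort by auto
  \<comment> \<open>\<open>f\<close> and \<open>g\<close> fix both sequences before the combined key
    is chosen. By \<open>same\<close>, every admissible key leads to this same merge tree, so the
    choice of key may depend on it.\<close>
  let ?T = "m (run f P) (run g Q)"
  have same: "run f P = run key P \<and> comparisons f P = comparisons key P"
    "run g Q = run key Q \<and> comparisons g Q = comparisons key Q"
    if "inj_on key (A \<union> B)" "same_order A f key" "same_order B g key" for key
    using that f(1) g(1) split.hyps(4,5) binary_mergesort_same_order by (auto simp: inj_on_Un)
  have sorts: "sorted_seq key (A \<union> B) (run key ?T)"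
    if "inj_on key (A \<union> B)" "same_order A f key" "same_order B g key" for key
  proof -
    have "sorted_seq key A (run f P)" "sorted_seq key B (run g Q)"
      using same[OF that] that(1) split.hyps(4,5) binary_mergesort_sorts by (auto simp: inj_on_Un)
    then show ?thesis
      using split.hyps(6) that(1) unfolding merging_procedure_def by blast
  qed
  have total: "comparisons key (bind P (\<lambda>xs. bind Q (\<lambda>ys. m xs ys))) z
      = comparisons f P z + comparisons g Q z + comparisons key ?T z"
    if "inj_on key (A \<union> B)" "same_order A f key" "same_order B g key" for key z
    using same[OF that] by (simp add: comparisons_bind)
  show ?case
  proof (cases "card B \<le> card A")
    case True
    obtain key where key: "inj_on key (A \<union> B)" "same_order A f key" "same_order B g key"
      "card B + 1 \<le> 2 ^ comparisons key ?T x"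
      using merge_adversary[OF fin(2) split.hyps(3) f(2,1) g(1) sorts] by blast
    have "(log 2 (card (A \<union> B)))\<^sup>2 / 8 \<le>
        comparisons key (bind P (\<lambda>xs. bind Q (\<lambda>ys. m xs ys))) x"
      using fin split.hyps(2,3) True f(3) key(4)
      by (rule log_square_card_step) (simp add: total[OF key(1-3)])
    then show ?thesis using key(1) f(2) by blast
  next
    case False
    \<comment> \<open>The parts swap roles and \<open>y\<close> is followed, but \<open>?T\<close>
      still takes its sequences in the original order.\<close>
    obtain key where key: "inj_on key (B \<union> A)" "same_order B g key" "same_order A f key"
      "card A + 1 \<le> 2 ^ comparisons key ?T y"
    proof (rule merge_adversary[OF fin(1) _ g(2,1) f(1)])
      show "B \<inter> A = {}"
        using split.hyps(3) by auto
      show "sorted_seq key (B \<union> A) (run key ?T)"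
        if "inj_on key (B \<union> A)" "same_order B g key" "same_order A f key" for key
        using sorts[of key] that by (simp add: Un_commute)
    qed (rule that)
    have "(log 2 (card (B \<union> A)))\<^sup>2 / 8 \<le>
        comparisons key (bind P (\<lambda>xs. bind Q (\<lambda>ys. m xs ys))) y"
      by (rule log_square_card_step[OF fin(2,1) split.hyps(1) _ _ g(3) key(4)])
        (use False split.hyps(3) key total in \<open>auto simp: Un_commute\<close>)
    then show ?thesis using key(1) g(2) by (auto simp: Un_commute)
  qed
qed

theorem theorem31:
  shows "\<exists>c::real. c > 0 \<and>
    (\<forall>n::nat. n \<ge> 1 \<longrightarrow>
      (\<forall>P :: (nat, nat list) ctree. binary_mergesort {..<n} P \<longrightarrow>
        (\<exists>key :: nat \<Rightarrow> nat. inj_on key {..<n} \<and>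
           real (fragile_complexity key {..<n} P) \<ge> c * (log 2 (real n))\<^sup>2)))"
proof (intro exI[of _ "1 / 8"] conjI allI impI)
  fix n :: nat and P :: "(nat, nat list) ctree"
  assume "binary_mergesort {..<n} P"
  then obtain key x where key: "inj_on key {..<n}" "x \<in> {..<n}"
    "(log 2 n)\<^sup>2 / 8 \<le> comparisons key P x"
    using binary_mergesort_lower_bound by fastforce
  have "comparisons key P x \<le> fragile_complexity key {..<n} P"
    unfolding fragile_complexity_def using key(2) by (intro Max_ge) auto
  with key show "\<exists>key. inj_on key {..<n} \<and>
      real (fragile_complexity key {..<n} P) \<ge> 1 / 8 * (log 2 (real n))\<^sup>2"
    by (intro exI[of _ key]) auto
qed simp

end
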